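(* Set $\beta(1)=\beta(2)=0$. For $n\ge3$, define $\beta(n)$ as follows. (a) If $\binom{2k}{2}<n\le\binom{2k+1}{2}$ for some nonnegative integer $k$, then $\beta(n)=1$ if $n$ is odd and $\beta(n)=0$ if $n$ is even. (b) If $\binom{2k+1}{2}<n\le\binom{2k+2}{2}$ for some nonnegative integer $k$, then $\beta(n)=1$ if $n$ is even and $\beta(n)=0$ if $n$ is odd. Then for any positive integer $n$ we have $a_2''(n)=\beta(n)$.
   Context: Notation: $(x;q^2)_0=1$ and $(x;q^2)_n=\prod_{j=0}^{n-1}(1-xq^{2j})$. Consider partitions of $n$ for which there are integers $l\ge2$, $1\le k\le l-1$ such that: there are exactly $l-1$ parts equal to $1$; the smallest even part is $2k$; every part greater than $1$ lies in the interval $[2k,2l-2]$; and the odd parts greater than $1$ are distinct. Then $a_2''(n)$ is the signed count of these partitions in which each partition is weighted by $(-1)^{j+1}$, where $j$ is its number of parts greater than $1$. Equivalently, as formal power series in $q$, \[ \sum_{n\ge0}a_2''(n)q^n=\sum_{\substack{l\ge2\\1\le k\le l-1}}\frac{(q^{2k+1};q^2)_{l-k-1}}{(-q^{2k};q^2)_{l-k}}q^{2k+l-1}. \] *)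

theory Defs
  imports Complex_Main "HOL-Library.Multiset"
begin

text \<open>A partition of \<open>n\<close> is the finite multiset of its parts.\<close>

definition partitions_of :: "nat \<Rightarrow> nat multiset set" where
  "partitions_of n = {P. 0 \<notin># P \<and> sum_mset P = n}"

definition admissible :: "nat multiset \<Rightarrow> bool" where
  "admissible P \<longleftrightarrow> (\<exists>l k. l \<ge> 2 \<and> 1 \<le> k \<and> k \<le> l - 1
     \<and> count P 1 = l - 1
     \<and> 2 * k \<in># P \<and> (\<forall>x\<in>#P. even x \<longrightarrow> 2 * k \<le> x)
     \<and> (\<forall>x\<in>#P. x > 1 \<longrightarrow> x \<in> {2 * k..2 * l - 2})
     \<and> (\<forall>x\<in>#P. odd x \<and> x > 1 \<longrightarrow> count P x = 1))"

definition a2'' :: "nat \<Rightarrow> int" where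
  "a2'' n = (\<Sum>P\<in>{P \<in> partitions_of n. admissible P}. (-1) ^ (size {#x \<in># P. x > 1#} + 1))"

text \<open>The last alternative in \<open>\<beta>\<close> is never reached for \<open>n \<ge> 3\<close>, see \<open>\<beta>_cases_exhaustive\<close>.
  The cases (a) and (b) are disjoint, see \<open>\<beta>_case_b\<close>.\<close>

definition \<beta> :: "nat \<Rightarrow> int" where
  "\<beta> n =
     (if n \<le> 2 then 0
      else if \<exists>k. (2 * k) choose 2 < n \<and> n \<le> (2 * k + 1) choose 2
        then (if odd n then 1 else 0)
      else if \<exists>k. (2 * k + 1) choose 2 < n \<and> n \<le> (2 * k + 2) choose 2
        then (if even n then 1 else 0)
      else 0)"

text \<open>The sum in \<open>a2''\<close> ranges over a finite set.\<close>

lemma finite_partitions_of: "finite (partitions_of n)"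
proof -
  have "partitions_of n \<subseteq> mset ` {xs. set xs \<subseteq> {..n} \<and> length xs \<le> n}"
  proof
    fix P assume P: "P \<in> partitions_of n"
    obtain xs where xs: "P = mset xs" by (metis ex_mset)
    have pos: "0 \<notin> set xs" and sum: "sum_list xs = n"
      using P by (auto simp: partitions_of_def xs sum_mset_sum_list)
    have "length xs \<le> sum_list xs"
      using pos by (induction xs) auto
    moreover have "set xs \<subseteq> {..n}"
      using sum member_le_sum_list by auto
    ultimately show "P \<in> mset ` {xs. set xs \<subseteq> {..n} \<and> length xs \<le> n}"
      using sum xs by auto
  qed
  moreover have "finite {xs. set xs \<subseteq> {..n} \<and> length xs \<le> n}"
    by (rule finite_lists_length_le) simp
  ultimately show ?thesis
    by (meson finite_imageI finite_subset)
qed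

lemma \<beta>_cases_exhaustive:
  assumes "n \<ge> 1"
  shows "(\<exists>k. (2 * k) choose 2 < n \<and> n \<le> (2 * k + 1) choose 2) \<or>
         (\<exists>k. (2 * k + 1) choose 2 < n \<and> n \<le> (2 * k + 2) choose 2)"
proof -
  define m where "m = (LEAST m. n \<le> m choose 2)"
  have "n \<le> Suc n choose 2"
    by (simp add: numeral_2_eq_2)
  then have m: "n \<le> m choose 2"
    unfolding m_def by (rule LeastI)
  then obtain j where j: "m = Suc j"
    using assms by (cases m) (auto simp: numeral_2_eq_2)
  have less: "j choose 2 < n"
    using not_less_Least[of j "\<lambda>m. n \<le> m choose 2"] j m_def by simp
  show ?thesis
  proof (cases "even j")
    case True
    then obtain k where "j = 2 * k" by blast
    then show ?thesis using less m j by auto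
  next
    case False
    then obtain k where "j = 2 * k + 1" using oddE by blast
    then show ?thesis using less m j by auto
  qed
qed

lemma \<beta>_case_b:
  assumes "n \<ge> 3" "(2 * k + 1) choose 2 < n" "n \<le> (2 * k + 2) choose 2"
  shows "\<beta> n = (if even n then 1 else 0)"
proof -
  have False if "(2 * i) choose 2 < n" "n \<le> (2 * i + 1) choose 2" for i
  proof (cases "i \<le> k")
    case True
    then have "(2 * i + 1) choose 2 \<le> (2 * k + 1) choose 2"
      by (intro binomial_right_mono) auto
    then show False using that assms by linarith
  next
    case False
    then have "(2 * k + 2) choose 2 \<le> (2 * i) choose 2"
      by (intro binomial_right_mono) auto
    then show False using that assms by linarith
  qed
  then show ?thesis
    using assms unfolding \<beta>_def by auto
qed

end

theory Submission
  imports Defs "HOL-Computational_Algebra.Formal_Power_Series"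
begin

text \<open>Write \<open>(x)\<^sub>m\<close> for the product of \<open>1 - x q^(2 i)\<close> over \<open>i < m\<close>. Fix the number \<open>m = l - 1\<close> of ones
  in a partition counted by \<open>a2''\<close> and let \<open>S\<^sub>m\<close> be the signed generating function of what is left,
  the parts greater than one, each part counted with sign \<open>-1\<close>. All these parts are at most \<open>2 m\<close>.
  Removing a part \<open>2 m\<close> or the part \<open>2 m - 1\<close>, when present, gives the recurrence
  \<open>(1 + q^(2 m)) S\<^sub>m = (1 - q^(2 m - 1)) S\<^sub>m\<^sub>-\<^sub>1 - q^(2 m)\<close> (\<open>signed_gf_cores_Suc\<close>).
  It has the constant solution \<open>-q / (1 + q)\<close>, and so \<open>S\<^sub>0 = 0\<close> forces
  \<open>(1 + q) S\<^sub>m = q ((q)\<^sub>m / (-q^2)\<^sub>m - 1)\<close> (\<open>signed_gf_cores_closed\<close>).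

  Since \<open>a2''\<close> has the generating function \<open>A = - (\<Sum>m. q^m S\<^sub>m)\<close>, everything is reduced to the series
  \<open>\<Sum>m. q^m (q)\<^sub>m / (-q^2)\<^sub>m\<close>, an instance of the Rogers--Fine function. It is the case \<open>x = q\<close> of
  \<open>G(x) = (\<Sum>m. x^m (x)\<^sub>m / (-x q)\<^sub>m)\<close>, which satisfies \<open>G(x) = 1 + x - x^2 q G(x q^2)\<close> because the
  series for \<open>G(x) + x^2 q G(x q^2)\<close> telescopes (\<open>rogers_fine_telescope\<close>). Iterating this equation along
  \<open>x = q, q^3, q^5, ...\<close> turns \<open>G(q)\<close> into the partial theta series
  \<open>\<Theta> = 1 + q - q^3 - q^6 + q^10 + q^15 - ...\<close> with triangular exponents
  (\<open>rogers_fine_eq_partial_theta\<close>). Hence \<open>(1 + q) A = q / (1 - q) - q \<Theta>\<close>, that is,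
  \<open>a2'' (n + 1) + a2'' n\<close> is one minus the coefficient of \<open>q^n\<close> in \<open>\<Theta>\<close> (\<open>a2''_consecutive\<close>).

  The numbers \<open>\<beta> n\<close> obey the same rule (\<open>\<beta>_consecutive\<close>). Inside a block between consecutive triangular
  numbers \<open>\<beta>\<close> alternates between 0 and 1, so neighbours add up to 1; from one block to the next the
  parity condition switches, so the two values at the border agree and add up to 0 or 2. Both sequences
  vanish at 0, and so they are equal.\<close>
unbundle fps_syntax

section \<open>Signed generating functions of sets of multisets\<close>

definition signed_gf :: "nat multiset set \<Rightarrow> rat fps" where
  "signed_gf A = Abs_fps (\<lambda>n. \<Sum>Q | Q \<in> A \<and> sum_mset Q = n. (-1) ^ size Q)"

lemma finite_sum_slice:
  fixes n :: nat
  assumes "\<forall>Q\<in>A. 0 \<notin># Q"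
  shows "finite {Q. Q \<in> A \<and> sum_mset Q = n}"
  by (rule finite_subset[OF _ finite_partitions_of[of n]]) (use assms in \<open>auto simp: partitions_of_def\<close>)

lemma signed_gf_Un:
  assumes "\<forall>Q\<in>A \<union> B. 0 \<notin># Q" "A \<inter> B = {}"
  shows "signed_gf (A \<union> B) = signed_gf A + signed_gf B"
proof (rule fps_ext)
  fix n :: nat
  have "{Q. Q \<in> A \<union> B \<and> sum_mset Q = n} =
      {Q. Q \<in> A \<and> sum_mset Q = n} \<union> {Q. Q \<in> B \<and> sum_mset Q = n}"
    by auto
  moreover have "finite {Q. Q \<in> A \<and> sum_mset Q = n}" "finite {Q. Q \<in> B \<and> sum_mset Q = n}"
    using assms(1) by (auto intro!: finite_sum_slice)
  ultimately show "signed_gf (A \<union> B) $ n = (signed_gf A + signed_gf B) $ n"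
    using assms(2) by (simp add: signed_gf_def, subst sum.union_disjoint) auto
qed

lemma signed_gf_empty [simp]: "signed_gf {} = 0"
  by (rule fps_ext) (simp add: signed_gf_def)

lemma signed_gf_empty_multiset [simp]: "signed_gf {{#}} = 1"
proof (rule fps_ext)
  fix n :: nat
  have "{Q. Q \<in> {{#}} \<and> sum_mset Q = n} = (if n = 0 then {{#}} else {})"
    by auto
  then show "signed_gf {{#}} $ n = (1 :: rat fps) $ n"
    by (simp add: signed_gf_def)
qed

text \<open>The minus sign is the reason for counting parts with sign: repeated parts \<open>x\<close> sum up to
  \<open>1 / (1 + q^x)\<close>, and an optional part \<open>x\<close> contributes \<open>1 - q^x\<close>.\<close>
lemma signed_gf_add_mset: "signed_gf (add_mset x ` A) = - (fps_X ^ x * signed_gf A)"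
proof (rule fps_ext)
  fix n :: nat
  have "{Q. Q \<in> add_mset x ` A \<and> sum_mset Q = n} =
      (if n < x then {} else add_mset x ` {Q. Q \<in> A \<and> sum_mset Q = n - x})"
    by auto
  then show "signed_gf (add_mset x ` A) $ n = (- (fps_X ^ x * signed_gf A)) $ n"
    by (simp add: signed_gf_def fps_X_power_mult_nth sum.reindex inj_on_def sum_negf)
qed

section \<open>The parts greater than one\<close>

text \<open>The multisets of parts greater than one of the admissible partitions with exactly \<open>m\<close> ones. The
  witness \<open>k\<close> is half of the smallest even part. The case \<open>m = 0\<close>, in which there are none,
  starts the recurrence.\<close>
definition cores :: "nat \<Rightarrow> nat multiset set" where
  "cores m = {Q. (\<exists>k\<ge>1. 2 * k \<in># Q \<and> (\<forall>x\<in>#Q. 2 * k \<le> x \<and> x \<le> 2 * m)) \<and>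
                 (\<forall>x\<in>#Q. odd x \<longrightarrow> count Q x = 1)}"

lemma coresI:
  assumes "k \<ge> 1" "2 * k \<in># Q" "\<And>x. x \<in># Q \<Longrightarrow> 2 * k \<le> x" "\<And>x. x \<in># Q \<Longrightarrow> x \<le> 2 * m"
    "\<And>x. x \<in># Q \<Longrightarrow> odd x \<Longrightarrow> count Q x = 1"
  shows "Q \<in> cores m"
  unfolding cores_def using assms by blast

lemma coresE:
  assumes "Q \<in> cores m"
  obtains k where "k \<ge> 1" "2 * k \<in># Q" "\<And>x. x \<in># Q \<Longrightarrow> 2 * k \<le> x" "\<And>x. x \<in># Q \<Longrightarrow> x \<le> 2 * m"
    "\<And>x. x \<in># Q \<Longrightarrow> odd x \<Longrightarrow> count Q x = 1"
  using assms unfolding cores_def by blast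

lemma cores_gt_one:
  assumes "Q \<in> cores m" "x \<in># Q"
  shows "1 < x"
proof -
  obtain k where "k \<ge> 1" "2 * k \<le> x" using assms by (metis coresE)
  then show ?thesis by linarith
qed

lemma cores_le: "Q \<in> cores m \<Longrightarrow> x \<in># Q \<Longrightarrow> x \<le> 2 * m"
  by (metis coresE)

lemma zero_notin_cores: "\<forall>Q\<in>cores m. 0 \<notin># Q"
  using cores_gt_one by (metis not_less_zero)

lemma cores_0: "cores 0 = {}"
proof -
  have False if Q: "Q \<in> cores 0" for Q
  proof -
    obtain k where "2 * k \<in># Q" using Q by (rule coresE)
    then show False using cores_gt_one[OF Q] cores_le[OF Q] by fastforce
  qed
  then show ?thesis by blast
qed

lemma cores_mono: "Q \<in> cores m \<Longrightarrow> Q \<in> cores (Suc m)"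
  by (erule coresE, rule coresI) (auto intro: le_SucI)

lemma cores_Suc_add_even:
  assumes "Q \<in> insert {#} (cores (Suc m))"
  shows "add_mset (2 * m + 2) Q \<in> cores (Suc m)"
proof (cases "Q = {#}")
  case True
  then show ?thesis
    by (intro coresI[of "Suc m"]) (auto split: if_splits)
next
  case False
  then have "Q \<in> cores (Suc m)" using assms by simp
  then obtain k where k: "k \<ge> 1" "2 * k \<in># Q" "\<And>x. x \<in># Q \<Longrightarrow> 2 * k \<le> x"
    "\<And>x. x \<in># Q \<Longrightarrow> x \<le> 2 * Suc m" "\<And>x. x \<in># Q \<Longrightarrow> odd x \<Longrightarrow> count Q x = 1"
    by (rule coresE) blast
  then have "2 * k \<le> 2 * m + 2" by fastforce
  show ?thesis
  proof (rule coresI[OF k(1)])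
    fix x assume x: "x \<in># add_mset (2 * m + 2) Q"
    show "2 * k \<le> x" "x \<le> 2 * Suc m"
      using x k(3,4) \<open>2 * k \<le> 2 * m + 2\<close> by auto
    assume "odd x"
    then have "x \<noteq> 2 * m + 2" by auto
    then show "count (add_mset (2 * m + 2) Q) x = 1" using x k(5) \<open>odd x\<close> by simp
  qed (use k(2) in simp)
qed

lemma cores_Suc_add_odd:
  assumes "Q \<in> cores m"
  shows "add_mset (2 * m + 1) Q \<in> cores (Suc m)"
proof -
  obtain k where k: "k \<ge> 1" "2 * k \<in># Q" "\<And>x. x \<in># Q \<Longrightarrow> 2 * k \<le> x"
    "\<And>x. x \<in># Q \<Longrightarrow> x \<le> 2 * m" "\<And>x. x \<in># Q \<Longrightarrow> odd x \<Longrightarrow> count Q x = 1"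
    using assms by (rule coresE) blast
  have "2 * k \<le> 2 * m" using k(2,4) by blast
  have notin: "2 * m + 1 \<notin># Q" using k(4)[of "2 * m + 1"] by auto
  show ?thesis
  proof (rule coresI[OF k(1)])
    fix x assume x: "x \<in># add_mset (2 * m + 1) Q"
    show "2 * k \<le> x" "x \<le> 2 * Suc m"
      using x k(3,4)[of x] \<open>2 * k \<le> 2 * m\<close> by auto
    assume "odd x"
    then show "count (add_mset (2 * m + 1) Q) x = 1"
      using x k(5) notin by (cases "x = 2 * m + 1") (auto simp: not_in_iff)
  qed (use k(2) in simp)
qed

text \<open>If the part removed is the smallest even part, then all parts are equal to \<open>2 m + 2\<close>, so either
  nothing remains or the smallest even part does not change.\<close>
lemma cores_Suc_remove_even:
  assumes Q: "add_mset (2 * m + 2) Q \<in> cores (Suc m)"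
  shows "Q \<in> insert {#} (cores (Suc m))"
proof (cases "Q = {#}")
  case False
  let ?P = "add_mset (2 * m + 2) Q"
  obtain k where k: "k \<ge> 1" "2 * k \<in># ?P" "\<And>x. x \<in># ?P \<Longrightarrow> 2 * k \<le> x"
    "\<And>x. x \<in># ?P \<Longrightarrow> x \<le> 2 * Suc m" "\<And>x. x \<in># ?P \<Longrightarrow> odd x \<Longrightarrow> count ?P x = 1"
    using Q by (rule coresE) blast
  have "2 * k \<in># Q"
  proof (cases "k = Suc m")
    case True
    obtain y where y: "y \<in># Q" using False by blast
    then have "y = 2 * k" using k(3,4)[of y] True by simp
    then show ?thesis using y by simp
  qed (use k(2) in auto)
  then have "Q \<in> cores (Suc m)"
  proof (rule coresI[OF k(1)])
    fix x assume x: "x \<in># Q"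
    show "2 * k \<le> x" "x \<le> 2 * Suc m" using x k(3,4) by auto
    assume "odd x"
    then have "x \<noteq> 2 * m + 2" by auto
    then show "count Q x = 1" using k(5)[of x] x \<open>odd x\<close> by simp
  qed
  then show ?thesis by simp
qed simp

lemma cores_Suc_restrict:
  assumes Q: "Q \<in> cores (Suc m)" "2 * m + 2 \<notin># Q" "2 * m + 1 \<notin># Q"
  shows "Q \<in> cores m"
proof -
  have "x \<le> 2 * m" if "x \<in># Q" for x
  proof -
    have "x \<le> 2 * m + 2" using cores_le[OF Q(1) that] by simp
    moreover have "x \<noteq> 2 * m + 1" "x \<noteq> 2 * m + 2" using that Q by auto
    ultimately show ?thesis by linarith
  qed
  then show ?thesis using Q(1) by (elim coresE, intro coresI) auto
qed

lemma cores_Suc_remove_odd: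
  assumes Q: "add_mset (2 * m + 1) Q \<in> cores (Suc m)" "2 * m + 2 \<notin># Q"
  shows "Q \<in> cores m"
proof -
  let ?P = "add_mset (2 * m + 1) Q"
  obtain k where k: "k \<ge> 1" "2 * k \<in># ?P" "\<And>x. x \<in># ?P \<Longrightarrow> 2 * k \<le> x"
    "\<And>x. x \<in># ?P \<Longrightarrow> x \<le> 2 * Suc m" "\<And>x. x \<in># ?P \<Longrightarrow> odd x \<Longrightarrow> count ?P x = 1"
    using Q(1) by (rule coresE) blast
  have notin: "2 * m + 1 \<notin># Q"
    using k(5)[of "2 * m + 1"] by (simp add: not_in_iff)
  have "2 * k \<noteq> 2 * m + 1" by presburger
  then have "2 * k \<in># Q" using k(2) by simp
  then have "Q \<in> cores (Suc m)"
  proof (rule coresI[OF k(1)])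
    fix x assume x: "x \<in># Q"
    show "2 * k \<le> x" "x \<le> 2 * Suc m" using x k(3,4) by auto
    assume "odd x"
    have "x \<noteq> 2 * m + 1" using x notin by auto
    then show "count Q x = 1" using k(5)[of x] x \<open>odd x\<close> by simp
  qed
  then show ?thesis using Q(2) notin by (rule cores_Suc_restrict)
qed

text \<open>The multisets with largest allowed part \<open>2 m + 2\<close> are sorted by the presence of \<open>2 m + 2\<close>, which can
  be repeated, and otherwise by the presence of \<open>2 m + 1\<close>, which cannot. The set itself occurs again on
  the right-hand side because after the removal of one copy of \<open>2 m + 2\<close> further copies may remain.\<close>
lemma cores_Suc:
  "cores (Suc m) = add_mset (2 * m + 2) ` insert {#} (cores (Suc m)) \<union>
     (add_mset (2 * m + 1) ` cores m \<union> cores m)" (is "_ = ?A \<union> (?B \<union> ?C)")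
proof
  show "?A \<union> (?B \<union> ?C) \<subseteq> cores (Suc m)"
    using cores_Suc_add_even cores_Suc_add_odd cores_mono by (auto simp del: add_2_eq_Suc')
  show "cores (Suc m) \<subseteq> ?A \<union> (?B \<union> ?C)"
  proof
    fix Q assume Q: "Q \<in> cores (Suc m)"
    show "Q \<in> ?A \<union> (?B \<union> ?C)"
    proof (cases "2 * m + 2 \<in># Q")
      case True
      then obtain R where "Q = add_mset (2 * m + 2) R" by (metis insert_DiffM)
      then show ?thesis using cores_Suc_remove_even Q by blast
    next
      case even: False
      show ?thesis
      proof (cases "2 * m + 1 \<in># Q")
        case True
        then obtain R where R: "Q = add_mset (2 * m + 1) R" by (metis insert_DiffM)
        then have "R \<in> cores m" using cores_Suc_remove_odd Q even by auto
        then show ?thesis using R by blast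
      next
        case False
        then show ?thesis using cores_Suc_restrict Q even by blast
      qed
    qed
  qed
qed

lemma signed_gf_cores_Suc:
  "(1 + fps_X ^ (2 * m + 2)) * signed_gf (cores (Suc m)) =
     (1 - fps_X ^ (2 * m + 1)) * signed_gf (cores m) - fps_X ^ (2 * m + 2)"
proof -
  let ?A = "add_mset (2 * m + 2) ` insert {#} (cores (Suc m))"
    and ?B = "add_mset (2 * m + 1) ` cores m" and ?C = "cores m"
  have nz: "\<forall>Q\<in>?A \<union> (?B \<union> ?C). 0 \<notin># Q"
    using zero_notin_cores by auto
  have gt: "2 * m + 1 \<notin># Q" "2 * m + 2 \<notin># Q" if "Q \<in> cores m" for Q
    using cores_le[OF that] by fastforce+
  have "?A \<inter> (?B \<union> ?C) = {}" "?B \<inter> ?C = {}"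
    using gt by (auto simp: add_eq_conv_ex) (metis union_single_eq_member)+
  then have "signed_gf (cores (Suc m)) = signed_gf ?A + (signed_gf ?B + signed_gf ?C)"
    using nz by (subst cores_Suc, subst signed_gf_Un) (auto simp: signed_gf_Un)
  also have "signed_gf ?A = - (fps_X ^ (2 * m + 2) * (1 + signed_gf (cores (Suc m))))"
  proof -
    have "{#} \<notin> cores (Suc m)" by (auto simp: cores_def)
    then have "signed_gf ({{#}} \<union> cores (Suc m)) = 1 + signed_gf (cores (Suc m))"
      using zero_notin_cores by (subst signed_gf_Un) auto
    then show ?thesis unfolding signed_gf_add_mset by simp
  qed
  also have "signed_gf ?B = - (fps_X ^ (2 * m + 1) * signed_gf (cores m))"
    by (rule signed_gf_add_mset)
  finally show ?thesis by (simp add: algebra_simps)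
qed

text \<open>The number \<open>l\<close> is determined by the ones, \<open>l = count P 1 + 1\<close>, so that \<open>2 l - 2\<close> is twice the number of
  ones, and \<open>k \<le> l - 1\<close> says that the part \<open>2 k\<close> lies in the interval.\<close>
lemma admissible_iff_cores:
  assumes "0 \<notin># P"
  shows "admissible P \<longleftrightarrow> count P 1 \<ge> 1 \<and> filter_mset (\<lambda>x. x > 1) P \<in> cores (count P 1)"
proof -
  have nz: "x \<noteq> 0" if "x \<in># P" for x using that assms by metis
  show ?thesis
  proof
    assume "admissible P"
    then obtain l k where lk: "l \<ge> 2" "1 \<le> k" "k \<le> l - 1" "count P 1 = l - 1" "2 * k \<in># P"
      "\<forall>x\<in>#P. even x \<longrightarrow> 2 * k \<le> x"
      "\<forall>x\<in>#P. x > 1 \<longrightarrow> x \<in> {2 * k..2 * l - 2}"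
      "\<forall>x\<in>#P. odd x \<and> x > 1 \<longrightarrow> count P x = 1"
      unfolding admissible_def by blast
    then have "2 * l - 2 = 2 * (l - 1)" by simp
    with lk show "count P 1 \<ge> 1 \<and> filter_mset (\<lambda>x. x > 1) P \<in> cores (count P 1)"
      by (auto simp: cores_def intro!: exI[of _ k])
  next
    assume asm: "count P 1 \<ge> 1 \<and> filter_mset (\<lambda>x. x > 1) P \<in> cores (count P 1)"
    define l where "l = count P 1 + 1"
    obtain k where k: "k \<ge> 1" "2 * k \<in># P"
      "\<And>x. x \<in># P \<Longrightarrow> x > 1 \<Longrightarrow> 2 * k \<le> x \<and> x \<le> 2 * count P 1"
      "\<And>x. x \<in># P \<Longrightarrow> x > 1 \<Longrightarrow> odd x \<Longrightarrow> count P x = 1"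
      using asm by (auto simp: cores_def)
    have "k \<le> count P 1" using k(1) k(2) k(3)[of "2 * k"] by simp
    moreover have "2 * k \<le> x" if "x \<in># P" "even x" for x
    proof -
      have "x > 1" using that nz[of x] by (cases "x = 1") auto
      then show ?thesis using k(3) that by blast
    qed
    moreover have "2 * l - 2 = 2 * count P 1" by (simp add: l_def)
    ultimately show "admissible P"
      unfolding admissible_def using k asm
      by (intro exI[of _ l] exI[of _ k]) (auto simp: l_def)
  qed
qed

text \<open>Partitions correspond to pairs of the number \<open>m\<close> of ones and the remaining parts, which sum to
  \<open>n - m\<close>. The minus sign comes from the exponent \<open>j + 1\<close> in the weight.\<close>
lemma a2''_eq_sum_cores:
  "of_int (a2'' n) = - (\<Sum>m = 1..n. signed_gf (cores m) $ (n - m))"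
proof -
  let ?S = "\<lambda>m. {Q. Q \<in> cores m \<and> sum_mset Q = n - m}"
  let ?h = "\<lambda>P::nat multiset. filter_mset (\<lambda>x. x > 1) P"
  have split: "P = replicate_mset (count P 1) 1 + ?h P" if "0 \<notin># P" for P :: "nat multiset"
  proof (rule multiset_eqI)
    fix x
    have "count P 0 = 0" using that by (simp add: not_in_iff)
    then show "count P x = count (replicate_mset (count P 1) 1 + ?h P) x"
      by (cases "x = 0"; cases "x = 1") auto
  qed
  have core: "count Q (Suc 0) = 0" "filter_mset ((<) (Suc 0)) Q = Q" if "Q \<in> cores m" for Q m
    using cores_gt_one[OF that] by (auto simp: not_in_iff[symmetric] filter_mset_eq_conv)
  have ones: "filter_mset ((<) (Suc 0)) (replicate_mset m (Suc 0)) = {#}" for m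
    by (induction m) auto
  have "(\<Sum>P | P \<in> partitions_of n \<and> admissible P. (-1) ^ (size (?h P) + 1)) =
      (\<Sum>(m, Q)\<in>Sigma {1..n} ?S. (-1 :: rat) ^ (size Q + 1))"
  proof (rule sum.reindex_bij_witness[of _ "\<lambda>(m, Q). replicate_mset m 1 + Q"
        "\<lambda>P. (count P 1, ?h P)"], goal_cases)
    case (1 P)
    then show ?case using split[of P] by (auto simp: partitions_of_def)
  next
    case (2 P)
    then have P: "0 \<notin># P" "sum_mset P = n" "admissible P" by (auto simp: partitions_of_def)
    have "n = count P 1 + sum_mset (?h P)"
      using arg_cong[OF split[OF P(1)], of sum_mset] P(2) by simp
    then show ?case using P admissible_iff_cores[OF P(1)] by auto
  next
    case (3 z)
    then show ?case by (auto simp: core ones)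
  next
    case (4 z)
    then obtain m Q where z: "z = (m, Q)" "m \<ge> 1" "m \<le> n" "Q \<in> cores m" "sum_mset Q = n - m"
      by auto
    have "0 \<notin># Q" using zero_notin_cores z by blast
    then show ?case using z by (auto simp: partitions_of_def admissible_iff_cores core ones)
  next
    case (5 P)
    then show ?case by simp
  qed
  also have "\<dots> = (\<Sum>m = 1..n. \<Sum>Q | Q \<in> cores m \<and> sum_mset Q = n - m. (-1) ^ (size Q + 1))"
    by (subst sum.Sigma) (auto intro!: finite_sum_slice zero_notin_cores)
  also have "\<dots> = - (\<Sum>m = 1..n. signed_gf (cores m) $ (n - m))"
    by (simp add: signed_gf_def sum_negf)
  finally show ?thesis by (simp add: a2''_def)
qed

section \<open>A Rogers--Fine identity\<close>

text \<open>The quotient \<open>(x; q\<^sup>2)\<^sub>m / (-x q; q\<^sup>2)\<^sub>m\<close> of two shifted factorials in the variable \<open>q = fps_X\<close>.\<close>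
definition pochhammer_ratio :: "rat fps \<Rightarrow> nat \<Rightarrow> rat fps" where
  "pochhammer_ratio x m =
     (\<Prod>i<m. (1 - x * fps_X ^ (2 * i)) * inverse (1 + x * fps_X ^ (2 * i + 1)))"

lemma pochhammer_ratio_0 [simp]: "pochhammer_ratio x 0 = 1"
  by (simp add: pochhammer_ratio_def)

lemma inverse_one_plus:
  assumes "y $ 0 = (0 :: rat)"
  shows "inverse (1 + y) * (1 + y) = 1"
  by (rule inverse_mult_eq_1) (simp add: assms)

lemma one_plus_nonzero:
  assumes "y $ 0 = (0 :: rat)"
  shows "1 + y \<noteq> 0"
  using assms by (metis add.right_neutral fps_add_nth fps_one_nth fps_zero_nth zero_neq_one)

lemma pochhammer_ratio_Suc:
  "pochhammer_ratio x (Suc m) * (1 + x * fps_X ^ (2 * m + 1)) =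
     pochhammer_ratio x m * (1 - x * fps_X ^ (2 * m))"
  using inverse_one_plus[of "x * fps_X ^ (2 * m + 1)"]
  by (simp add: pochhammer_ratio_def mult.assoc)

text \<open>Passing from \<open>x\<close> to \<open>x q\<^sup>2\<close> drops the first factor of both products and adds one at the end. The
  denominators are cleared because power series do not form a field.\<close>
lemma pochhammer_ratio_shift:
  assumes "x $ 0 = 0"
  shows "pochhammer_ratio (x * fps_X\<^sup>2) m * (1 - x) * (1 + x * fps_X ^ (2 * m + 1)) =
     pochhammer_ratio x m * (1 - x * fps_X ^ (2 * m)) * (1 + x * fps_X)"
proof (induction m)
  case (Suc m)
  define q y where "q = (fps_X :: rat fps)" and "y = q ^ (2 * m)"
  define u u' where "u = pochhammer_ratio x m" and "u' = pochhammer_ratio x (Suc m)"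
  define v v' where "v = pochhammer_ratio (x * q\<^sup>2) m"
    and "v' = pochhammer_ratio (x * q\<^sup>2) (Suc m)"
  have v': "v' * (1 + x * y * q ^ 3) = v * (1 - x * y * q\<^sup>2)"
    using pochhammer_ratio_Suc[of "x * q\<^sup>2" m]
    by (simp add: v_def v'_def y_def q_def power_add algebra_simps eval_nat_numeral)
  have u': "u' * (1 + x * y * q) = u * (1 - x * y)"
    using pochhammer_ratio_Suc[of x m]
    by (simp add: u_def u'_def y_def q_def power_add algebra_simps)
  have IH: "v * (1 - x) * (1 + x * y * q) = u * (1 - x * y) * (1 + x * q)"
    using Suc by (simp add: u_def v_def y_def q_def algebra_simps)
  have "1 + x * y * q \<noteq> 0" by (rule one_plus_nonzero) (simp add: assms)
  moreover have "(v' * (1 - x) * (1 + x * y * q ^ 3)) * (1 + x * y * q) =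
      (u' * (1 - x * y * q\<^sup>2) * (1 + x * q)) * (1 + x * y * q)"
    using u' v' IH by algebra
  ultimately have "v' * (1 - x) * (1 + x * y * q ^ 3) = u' * (1 - x * y * q\<^sup>2) * (1 + x * q)"
    by simp
  then show ?case
    by (simp add: u'_def v'_def y_def q_def power_add algebra_simps eval_nat_numeral)
qed simp

definition rogers_fine_partial :: "nat \<Rightarrow> rat fps \<Rightarrow> rat fps" where
  "rogers_fine_partial M x = (\<Sum>m<M. x ^ m * pochhammer_ratio x m)"

text \<open>With \<open>u m\<close> and \<open>v m\<close> for the \<open>m\<close>-th terms of the series at \<open>x\<close> and at \<open>x q\<^sup>2\<close>, the combination
  \<open>u m + x\<^sup>2 q (v m)\<close> is the difference \<open>W m - W (m + 1)\<close>, where \<open>W m = (1 - x\<^sup>2 q^(2 m)) / (1 - x) (u m)\<close>.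
  This certificate is found by trying \<open>W m = r m * u m\<close> with \<open>r m\<close> linear in \<open>q^(2 m)\<close> and comparing
  coefficients. The factor \<open>1 - x\<close> multiplies everything to avoid the division.\<close>
lemma rogers_fine_telescope:
  assumes "x $ 0 = 0"
  shows "(1 - x) * (rogers_fine_partial M x + x\<^sup>2 * fps_X * rogers_fine_partial M (x * fps_X\<^sup>2)) =
     (1 - x\<^sup>2) - (1 - x\<^sup>2 * fps_X ^ (2 * M)) * (x ^ M * pochhammer_ratio x M)"
proof (induction M)
  case 0
  then show ?case by (simp add: rogers_fine_partial_def)
next
  case (Suc M)
  define q y w where "q = (fps_X :: rat fps)" and "y = q ^ (2 * M)" and "w = x ^ M"
  define u u' v where "u = pochhammer_ratio x M" and "u' = pochhammer_ratio x (Suc M)"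
    and "v = pochhammer_ratio (x * q\<^sup>2) M"
  define a b where "a = rogers_fine_partial M x" and "b = rogers_fine_partial M (x * q\<^sup>2)"
  have u': "u' * (1 + x * y * q) = u * (1 - x * y)"
    using pochhammer_ratio_Suc[of x M]
    by (simp add: u_def u'_def y_def q_def power_add algebra_simps)
  have v: "v * (1 - x) * (1 + x * y * q) = u * (1 - x * y) * (1 + x * q)"
    using pochhammer_ratio_shift[OF assms, of M]
    by (simp add: u_def v_def y_def q_def power_add algebra_simps)
  have "1 + x * y * q \<noteq> 0" by (rule one_plus_nonzero) (simp add: assms)
  moreover have "((1 - x) * (u + x\<^sup>2 * q * (y * v))) * (1 + x * y * q) =
      ((1 - x\<^sup>2 * y) * u - (1 - x\<^sup>2 * y * q\<^sup>2) * (x * u')) * (1 + x * y * q)"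
    using u' v by algebra
  ultimately have step: "(1 - x) * (u + x\<^sup>2 * q * (y * v)) =
      (1 - x\<^sup>2 * y) * u - (1 - x\<^sup>2 * y * q\<^sup>2) * (x * u')"
    by simp
  have IH: "(1 - x) * (a + x\<^sup>2 * q * b) = (1 - x\<^sup>2) - (1 - x\<^sup>2 * y) * (w * u)"
    using Suc.IH by (simp add: a_def b_def w_def u_def y_def q_def)
  have "(1 - x) * ((a + w * u) + x\<^sup>2 * q * (b + w * y * v)) =
      (1 - x\<^sup>2) - (1 - x\<^sup>2 * (y * q\<^sup>2)) * (w * x * u')"
    using step IH by algebra
  moreover have "rogers_fine_partial (Suc M) x = a + w * u"
    by (simp add: rogers_fine_partial_def a_def w_def u_def)
  moreover have "rogers_fine_partial (Suc M) (x * fps_X\<^sup>2) = b + w * y * v"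
    by (simp add: rogers_fine_partial_def b_def w_def y_def v_def q_def power_mult_distrib
        power_mult[symmetric])
  moreover have "fps_X ^ (2 * Suc M) = y * q\<^sup>2" "x ^ Suc M = w * x"
    by (simp_all add: y_def q_def w_def power2_eq_square algebra_simps)
  ultimately show ?case by (simp only: q_def u'_def)
qed

text \<open>The boundary term \<open>W M\<close> of the telescoping sum contains the factor \<open>x^M\<close>, and \<open>1 - x\<close> is a unit.
  Working modulo \<open>q^M\<close> with partial sums replaces all convergence arguments.\<close>
lemma rogers_fine_step:
  assumes "fps_X dvd x"
  shows "fps_X ^ M dvd rogers_fine_partial M x -
     (1 + x - x\<^sup>2 * fps_X * rogers_fine_partial M (x * fps_X\<^sup>2))"
proof -
  let ?D = "rogers_fine_partial M x -
     (1 + x - x\<^sup>2 * fps_X * rogers_fine_partial M (x * fps_X\<^sup>2))"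
  have x0: "x $ 0 = 0" using assms by (auto elim!: dvdE)
  have "?D * (1 - x) = - ((1 - x\<^sup>2 * fps_X ^ (2 * M)) * (x ^ M * pochhammer_ratio x M))"
    using rogers_fine_telescope[OF x0, of M] by (simp add: algebra_simps power2_eq_square)
  also have "fps_X ^ M dvd \<dots>"
    using dvd_power_same[OF assms, of M] by simp
  finally have "fps_X ^ M dvd ?D * (1 - x) * inverse (1 - x)"
    by (rule dvd_mult2)
  moreover have "(1 - x) * inverse (1 - x) = 1"
    using inverse_one_plus[of "- x"] x0 by (simp add: mult.commute)
  ultimately show ?thesis by (simp add: mult.assoc)
qed

text \<open>The first \<open>N\<close> terms of \<open>1 + q - q\<^sup>3 - q\<^sup>6 + q^10 + q^15 - ...\<close>.\<close>
definition partial_theta :: "nat \<Rightarrow> rat fps" where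
  "partial_theta N = (\<Sum>j<N. (-1) ^ (j div 2) * fps_X ^ (Suc j choose 2))"

lemma odd_choose_two: "(2 * N + 1) choose 2 = N * (2 * N + 1)"
  by (simp add: choose_two)

lemma even_choose_two: "(2 * N + 2) choose 2 = N * (2 * N + 1) + (2 * N + 1)"
  by (simp add: choose_two algebra_simps)

text \<open>One step at \<open>x = q^(2 N + 1)\<close> produces the two terms \<open>1 + x\<close>, whose exponents after multiplication with
  \<open>q^(N (2 N + 1))\<close> are consecutive triangular numbers, and the new factor \<open>- x\<^sup>2 q = - q^(4 N + 3)\<close>,
  which raises the exponent \<open>N (2 N + 1)\<close> to \<open>(N + 1) (2 N + 3)\<close>.\<close>
lemma rogers_fine_iterate:
  "fps_X ^ M dvd rogers_fine_partial M fps_X - partial_theta (2 * N) -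
     (-1) ^ N * fps_X ^ (N * (2 * N + 1)) * rogers_fine_partial M (fps_X ^ (2 * N + 1))"
proof (induction N)
  case 0
  then show ?case by (simp add: partial_theta_def)
next
  case (Suc N)
  let ?q = "fps_X :: rat fps"
  let ?x = "?q ^ (2 * N + 1)" and ?e = "(-1) ^ N * ?q ^ (N * (2 * N + 1))"
  let ?G = "rogers_fine_partial M"
  have "?q ^ M dvd ?e * (?G ?x - (1 + ?x - ?x\<^sup>2 * ?q * ?G (?x * ?q\<^sup>2)))"
    by (intro dvd_mult rogers_fine_step) simp
  then have dvd: "?q ^ M dvd (?G ?q - partial_theta (2 * N) - ?e * ?G ?x) +
      ?e * (?G ?x - (1 + ?x - ?x\<^sup>2 * ?q * ?G (?x * ?q\<^sup>2)))"
    using Suc.IH by (rule dvd_add[rotated])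
  have e1: "?q ^ (Suc (2 * N) choose 2) = ?q ^ (N * (2 * N + 1))"
    using odd_choose_two[of N] by simp
  have e2: "?q ^ (Suc (Suc (2 * N)) choose 2) = ?q ^ (N * (2 * N + 1)) * ?x"
  proof -
    have "Suc (Suc (2 * N)) choose 2 = N * (2 * N + 1) + (2 * N + 1)"
      using even_choose_two[of N] by simp
    then show ?thesis by (simp only: power_add)
  qed
  have theta: "partial_theta (2 * Suc N) = partial_theta (2 * N) + ?e * (1 + ?x)"
  proof -
    have "partial_theta (2 * Suc N) = partial_theta (2 * N) +
        ((-1) ^ N * ?q ^ (Suc (2 * N) choose 2) + (-1) ^ N * ?q ^ (Suc (Suc (2 * N)) choose 2))"
      by (simp add: partial_theta_def del: binomial_Suc_Suc)
    then show ?thesis unfolding e1 e2 by (simp only: distrib_left mult_1_right mult.assoc)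
  qed
  have next_x: "?x * ?q\<^sup>2 = ?q ^ (2 * Suc N + 1)"
    by (simp add: power_add power2_eq_square)
  have "Suc N * (2 * Suc N + 1) = N * (2 * N + 1) + (2 * N + 1) * 2 + 1" by simp
  then have next_e: "(-1) ^ Suc N * ?q ^ (Suc N * (2 * Suc N + 1)) = - (?e * ?x\<^sup>2 * ?q)"
    by (simp only: power_add power_mult power_one_right) (simp add: mult.assoc)
  have "?G ?q - partial_theta (2 * Suc N) -
      (-1) ^ Suc N * ?q ^ (Suc N * (2 * Suc N + 1)) * ?G (?q ^ (2 * Suc N + 1)) =
      (?G ?q - partial_theta (2 * N) - ?e * ?G ?x) +
      ?e * (?G ?x - (1 + ?x - ?x\<^sup>2 * ?q * ?G (?x * ?q\<^sup>2)))"
    unfolding theta next_e next_x[symmetric] by (simp add: algebra_simps)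
  with dvd show ?case by (simp only:)
qed

text \<open>After \<open>M\<close> iterations the remainder carries the factor \<open>q^(M (2 M + 1))\<close>, which vanishes modulo \<open>q^M\<close>.\<close>
lemma rogers_fine_eq_partial_theta:
  assumes "i < M"
  shows "rogers_fine_partial M fps_X $ i = partial_theta (2 * M) $ i"
proof -
  let ?q = "fps_X :: rat fps"
  have "?q ^ M dvd (-1) ^ M * ?q ^ (M * (2 * M + 1)) * rogers_fine_partial M (?q ^ (2 * M + 1))"
    by (intro dvd_mult2 dvd_mult le_imp_power_dvd) simp
  from dvd_add[OF rogers_fine_iterate[of M M] this]
  have "?q ^ M dvd rogers_fine_partial M ?q - partial_theta (2 * M)" by simp
  then obtain h where "rogers_fine_partial M ?q - partial_theta (2 * M) = ?q ^ M * h" by (rule dvdE)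
  then have "(rogers_fine_partial M ?q - partial_theta (2 * M)) $ i = 0"
    using assms by (simp add: fps_X_power_mult_nth)
  then show ?thesis by simp
qed

section \<open>The generating function of \<open>a2''\<close>\<close>

text \<open>The recurrence for the cores is that of \<open>pochhammer_ratio\<close> up to its constant solution
  \<open>- q / (1 + q)\<close>.\<close>
lemma signed_gf_cores_closed:
  "(1 + fps_X) * signed_gf (cores m) = fps_X * (pochhammer_ratio fps_X m - 1)"
proof (induction m)
  case 0
  then show ?case by (simp add: cores_0)
next
  case (Suc m)
  define q y where "q = (fps_X :: rat fps)" and "y = q ^ (2 * m)"
  define g g' where "g = signed_gf (cores m)" and "g' = signed_gf (cores (Suc m))"
  define r r' where "r = pochhammer_ratio q m" and "r' = pochhammer_ratio q (Suc m)"
  have g': "(1 + y * q\<^sup>2) * g' = (1 - y * q) * g - y * q\<^sup>2"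
    using signed_gf_cores_Suc[of m]
    by (simp add: g_def g'_def y_def q_def power_add power2_eq_square algebra_simps)
  have r': "r' * (1 + y * q\<^sup>2) = r * (1 - y * q)"
    using pochhammer_ratio_Suc[of q m]
    by (simp add: r_def r'_def y_def q_def power_add power2_eq_square algebra_simps)
  have IH: "(1 + q) * g = q * (r - 1)"
    using Suc by (simp add: q_def g_def r_def)
  have "1 + y * q\<^sup>2 \<noteq> 0" by (rule one_plus_nonzero) (simp add: q_def)
  moreover have "((1 + q) * g') * (1 + y * q\<^sup>2) = (q * (r' - 1)) * (1 + y * q\<^sup>2)"
    using g' r' IH by algebra
  ultimately have "(1 + q) * g' = q * (r' - 1)" by simp
  then show ?case by (simp add: q_def g'_def r'_def)
qed

text \<open>The coefficient of \<open>q^(n + 1)\<close> in \<open>(1 + q) A = q / (1 - q) - q G(q)\<close>. Since the term with index \<open>m\<close> is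
  divisible by \<open>q^m\<close> in both series, the first \<open>n + 2\<close> terms determine this coefficient.\<close>
lemma a2''_consecutive:
  "of_int (a2'' (Suc n) + a2'' n) = 1 - partial_theta (2 * (n + 2)) $ n"
proof -
  let ?q = "fps_X :: rat fps" and ?g = "\<lambda>m. signed_gf (cores m)"
  define M where "M = n + 2"
  define A where "A = - (\<Sum>m<M. ?q ^ m * ?g m)"
  have A: "A $ i = of_int (a2'' i)" if "i < M" for i
  proof -
    have "A $ i = - (\<Sum>m<M. if i < m then 0 else ?g m $ (i - m))"
      by (simp add: A_def fps_sum_nth fps_X_power_mult_nth)
    also have "(\<Sum>m<M. if i < m then 0 else ?g m $ (i - m)) = (\<Sum>m = 1..i. ?g m $ (i - m))"
      using that by (intro sum.mono_neutral_cong_right) (auto simp: cores_0 not_le Suc_le_eq)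
    finally show ?thesis by (simp add: a2''_eq_sum_cores)
  qed
  have "(1 + ?q) * A = - (\<Sum>m<M. ?q ^ m * ((1 + ?q) * ?g m))"
    by (simp add: A_def sum_distrib_left mult.left_commute)
  also have "\<dots> = ?q * ((\<Sum>m<M. ?q ^ m) - rogers_fine_partial M ?q)"
    unfolding signed_gf_cores_closed rogers_fine_partial_def sum_subtractf[symmetric]
      sum_distrib_left sum_negf[symmetric]
    by (intro sum.cong) (auto simp: algebra_simps)
  finally have "((1 + ?q) * A) $ Suc n = (?q * ((\<Sum>m<M. ?q ^ m) - rogers_fine_partial M ?q)) $ Suc n"
    by simp
  moreover have "(\<Sum>m<M. ?q ^ m) $ n = 1"
  proof -
    have "n < M" by (simp add: M_def)
    then show ?thesis by (simp add: fps_sum_nth)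
  qed
  ultimately show ?thesis
    using rogers_fine_eq_partial_theta[of n M] A[of n] A[of "Suc n"]
    by (simp add: M_def distrib_right)
qed

section \<open>Triangular blocks\<close>

text \<open>Cases (a) and (b) are one rule when the block is numbered by \<open>j\<close>: \<open>n\<close> and \<open>j\<close> have opposite parity.
  The rule also covers \<open>n = 1\<close> (with \<open>j = 1\<close>) and \<open>n = 2\<close> (with \<open>j = 2\<close>).\<close>
lemma \<beta>_eq:
  assumes "j choose 2 < n" "n \<le> Suc j choose 2"
  shows "\<beta> n = (if even (n + j) then 0 else 1)"
proof (cases "n \<le> 2")
  case True
  have "j \<le> 2"
  proof (rule ccontr)
    assume "\<not> j \<le> 2"
    then have "3 choose 2 \<le> j choose 2" by (intro binomial_right_mono) simp
    moreover have "3 choose 2 = (3::nat)" by (simp add: choose_two)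
    ultimately show False using True assms(1) by simp
  qed
  then have "j = 0 \<or> j = 1 \<or> j = 2" by auto
  then have "n = j \<and> (j = 1 \<or> j = 2)" using assms True by (auto simp: choose_two)
  then show ?thesis by (auto simp: \<beta>_def)
next
  case False
  show ?thesis
  proof (cases "even j")
    case True
    then obtain k where k: "j = 2 * k" by blast
    then have "\<exists>k. (2 * k) choose 2 < n \<and> n \<le> (2 * k + 1) choose 2" using assms by auto
    then show ?thesis using False k by (simp add: \<beta>_def)
  next
    case False
    then obtain k where k: "j = 2 * k + 1" using oddE by blast
    then show ?thesis using \<open>\<not> n \<le> 2\<close> assms \<beta>_case_b[of n k] by simp
  qed
qed

lemma choose_two_less: "1 \<le> i \<Longrightarrow> i < j \<Longrightarrow> i choose 2 < j choose 2"
proof (induction j)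
  case (Suc j)
  then show ?case by (cases "i = j") (auto simp: numeral_2_eq_2)
qed simp

text \<open>Modulo 2, the triangular numbers have period 4. The sign of a term of the partial theta series is
  negative exactly when the triangular number that follows its exponent is even.\<close>
lemma even_triangular: "even (Suc (Suc i) choose 2) \<longleftrightarrow> odd (i div 2)"
proof -
  have "Suc (Suc (n + 4)) choose 2 = (Suc (Suc n) choose 2) + 2 * (2 * n + 7)" for n :: nat
    by (simp add: numeral_eq_Suc)
  then show ?thesis
  proof (induction i rule: less_induct)
    case (less i)
    show ?case
    proof (cases "i < 4")
      case True
      then have "i = 0 \<or> i = 1 \<or> i = 2 \<or> i = 3" by auto
      then show ?thesis by (auto simp: choose_two)
    next
      case False
      then obtain n where n: "i = n + 4" by (metis le_add_diff_inverse2 not_less)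
      then have "even (Suc (Suc i) choose 2) \<longleftrightarrow> even (Suc (Suc n) choose 2)"
        using less.prems by simp
      also have "\<dots> \<longleftrightarrow> odd (n div 2)" using less n by simp
      also have "\<dots> \<longleftrightarrow> odd (i div 2)"
      proof -
        have "i div 2 = n div 2 + 2" using n by simp
        then show ?thesis by simp
      qed
      finally show ?thesis .
    qed
  qed
qed

lemma partial_theta_nth:
  "partial_theta N $ n = (\<Sum>j<N. if n = Suc j choose 2 then (-1) ^ (j div 2) else 0)"
proof -
  have "((-1) ^ k * fps_X ^ e :: rat fps) $ n = (if n = e then (-1) ^ k else 0)" for k e
    by (cases "even k") auto
  then show ?thesis by (simp add: partial_theta_def fps_sum_nth)
qed

text \<open>A triangular number \<open>n\<close> ends the block \<open>i\<close> and \<open>n + 1\<close> starts the block \<open>i + 1\<close>, so both values of \<open>\<beta>\<close>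
  are decided by the parity of the same sum \<open>n + i\<close>. That sum has the opposite parity of the next
  triangular number \<open>n + i + 1\<close>.\<close>
lemma \<beta>_consecutive:
  "of_int (\<beta> (Suc n) + \<beta> n) = 1 - partial_theta (2 * (n + 2)) $ n"
proof -
  obtain j where j: "j choose 2 < Suc n" "Suc n \<le> Suc j choose 2"
    using \<beta>_cases_exhaustive[of "Suc n"] by auto
  then obtain i where i: "j = Suc i" by (cases j) (auto simp: numeral_2_eq_2)
  have "(if n = Suc a choose 2 then (-1) ^ (a div 2) else 0) =
      (if a = i then if n = j choose 2 then (-1) ^ (i div 2) else 0 else (0::rat))" for a
    using choose_two_less[of "Suc a" j] choose_two_less[of j "Suc a"]
      choose_two_less[of "Suc j" "Suc a"] j i
    by (cases "Suc a" j rule: linorder_cases; cases "Suc a" "Suc j" rule: linorder_cases) auto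
  moreover have "i \<le> n"
  proof -
    have "i \<le> Suc i choose 2" by (simp add: numeral_2_eq_2)
    then show ?thesis using j i by simp
  qed
  ultimately have theta: "partial_theta (2 * (n + 2)) $ n = (if n = j choose 2 then (-1) ^ (i div 2) else 0)"
    by (simp add: partial_theta_nth)
  have \<beta>1: "\<beta> (Suc n) = (if even (Suc n + j) then 0 else 1)" by (rule \<beta>_eq[OF j])
  show ?thesis
  proof (cases "n = j choose 2")
    case True
    have pascal: "Suc j choose 2 = (j choose 2) + j" by (simp add: numeral_2_eq_2)
    have "\<beta> n = (if even (n + i) then 0 else 1)"
      \<comment> \<open>The border at 0 is special: 0 is below all blocks, and its value is set by definition.\<close>
    proof (cases "n = 0")
      case True
      then have "j = 1"
        using choose_two_less[of 1 j] i \<open>n = j choose 2\<close> by (cases "j = 1") auto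
      then show ?thesis using True i by (simp add: \<beta>_def)
    next
      case False
      then have "i choose 2 < n" using True i choose_two_less[of i j] by (cases "i = 0") auto
      then show ?thesis using True i by (intro \<beta>_eq) auto
    qed
    moreover have "even (n + j) \<longleftrightarrow> odd (i div 2)"
      using even_triangular[of i] pascal True i by simp
    ultimately show ?thesis using theta True \<beta>1 i by (auto simp: uminus_power_if)
  next
    case False
    then have "\<beta> n = (if even (n + j) then 0 else 1)" using j by (intro \<beta>_eq) auto
    then show ?thesis using theta False \<beta>1 by auto
  qed
qed

theorem corollary1:
  fixes n :: nat
  assumes "n \<ge> 1"
  shows "a2'' n = \<beta> n"
proof -
  have "a2'' n = \<beta> n" for n
  proof (induction n)
    case 0
    have "of_int (a2'' 0) = (0 :: rat)" by (simp add: a2''_eq_sum_cores)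
    then show ?case by (simp add: \<beta>_def)
  next
    case (Suc n)
    have "of_int (a2'' (Suc n) + a2'' n) = (of_int (\<beta> (Suc n) + \<beta> n) :: rat)"
      by (simp only: a2''_consecutive \<beta>_consecutive)
    then have "a2'' (Suc n) + a2'' n = \<beta> (Suc n) + \<beta> n" by (simp only: of_int_eq_iff)
    then show ?case using Suc by simp
  qed
  then show ?thesis .
qed

end
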